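(* Let $(A,M,\{P_x\}_{x\in X})$ be a homotopy matching relative Rota-Baxter algebra, with $A_\infty$-algebra $(A,\{\mu_k\}_{k\ge1})$ and bimodule $(M,\{\eta_k\}_{k\ge1})$. Then $(M,\{\pi_k\}_{k\ge1})$ is a homotopy matching dendriform algebra, where $$(\pi_k)^{[r]}_{x_1,\dots,x_k}(u_1,\dots,u_k)=\eta_k\big(P_{x_1}(u_1),\dots,u_r,\dots,P_{x_k}(u_k)\big),$$ for $u_i\in M$, $x_i\in X$ $(i=1,\dots,k)$ and $[r]\in C_k$ (on the right side $P_{x_j}$ is applied to every $u_j$ with $j\ne r$).
   Context: $\mathbb K$ is a commutative unital ring with $\mathrm{char}\,\mathbb K\neq 2$; all modules, linear maps, Hom spaces and tensor products are over $\mathbb K$; $X$ is a nonempty set; $|a|$ is the degree of a homogeneous element $a$. An $A_\infty$-algebra is a $\mathbb Z$-graded $\mathbb K$-module $A=\oplus_{i\in\mathbb Z}A^i$ with graded linear maps $\mu_k:A^{\otimes k}\to A$, $\deg\mu_k=k-2$ $(k\ge1)$, such that for all $n\ge1$ and homogeneous $a_1,\dots,a_n$, $$\sum_{k+l=n+1}\sum_{i=1}^k(-1)^{i(l+1)+l(|a_1|+\cdots+|a_{i-1}|)}\mu_k(a_1,\dots,a_{i-1},\mu_l(a_i,\dots,a_{i+l-1}),a_{i+l},\dots,a_n)=0.\quad( * )$$ A representation (bimodule) of it is a graded $\mathbb K$-module $M=\oplus_{i\in\mathbb Z} M^i$ with graded linear maps $\eta_k:\mathcal A^{k-1,1}\to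 M$, $\deg\eta_k=k-2$ $(k\ge1)$, where $\mathcal A^{k-1,1}$ is the direct sum of all $k$-fold tensor products of $A$ and $M$ with $A$ appearing $k-1$ times and $M$ exactly once, satisfying $( * )$ when exactly one of $a_1,\dots,a_n$ comes from $M$ and each operation $\mu_k$ or $\mu_l$ having an input from $M$ is replaced by $\eta_k$ or $\eta_l$. A homotopy matching relative Rota-Baxter algebra is a triple $(A,M,\{P_x\}_{x\in X})$ with $(A,\{\mu_k\})$ an $A_\infty$-algebra, $(M,\{\eta_k\})$ a bimodule over it and $P_x:M\to A$ degree $0$ linear maps such that for all $k\ge1$, $u_i\in M$, $x_i\in X$: $\mu_k(P_{x_1}(u_1),\dots,P_{x_k}(u_k))=\sum_{r=1}^kP_{x_r}\big(\eta_k(P_{x_1}(u_1),\dots,u_r,\dots,P_{x_k}(u_k))\big)$. For a graded $\mathbb K$-module $D$, let $C_k=\{[1],\dots,[k]\}$ and let $\mathcal O_D(k)$ be the set of families $f=\oplus_{x_1,\dots,x_k\in X}f_{x_1,\dots,x_k}$, $f_{x_1,\dots,x_k}\in\mathrm{Hom}(\mathbb K[C_k]\otimes D^{\otimes k},D)$ ($\mathbb K[C_k]$ the free module on $C_k$), such that $f^{[r]}_{x_1,\dots,x_k}:=f_{x_1,\dots,x_k}([r];-,\dots,-)$ does not depend on $x_r$ for $1\le r\le k$. A homotopy matching dendriform algebra is a pair $(D,\{\pi_k\}_{k\ge1})$ with $D=\oplus_{i\in\mathbb Z}D^i$ and $\pi_k\in\mathcal O_D(k)$, $\deg((\pi_k)^{[r]}_{x_1,\dots,x_k})=k-2$,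 such that for all $n\geq 1$, homogeneous $a_1,\dots,a_n\in D$, $x_1,\dots,x_n\in X$, $[r]\in C_n$, $$\sum_{k+l=n+1}\sum_{i=1}^k(-1)^{i(l+1)+l(|a_1|+\cdots+|a_{i-1}|)}(\pi_k\circ_i\pi_l)^{[r]}_{x_1,\dots,x_n}(a_1,\dots,a_n)=0,$$ where for $f\in\mathcal O_D(k)$, $g\in\mathcal O_D(l)$ the term $(f\circ_ig)^{[r]}_{x_1,\dots,x_{k+l-1}}(a_1,\dots,a_{k+l-1})$ is - if $1\le r\le i-1$: $\sum_{s=1}^lf^{[r]}_{x_1,\dots,x_{i-1},x_{i-1+s},x_{i+l},\dots,x_{k+l-1}}(a_1,\dots,a_{i-1},g^{[s]}_{x_i,\dots,x_{i+l-1}}(a_i,\dots,a_{i+l-1}),a_{i+l},\dots,a_{k+l-1})$; - if $i\le r\le i+l-1$: $f^{[i]}_{x_1,\dots,x_{i-1},x_r,x_{i+l},\dots,x_{k+l-1}}(a_1,\dots,a_{i-1},g^{[r-i+1]}_{x_i,\dots,x_{i+l-1}}(a_i,\dots,a_{i+l-1}),a_{i+l},\dots,a_{k+l-1})$; - if $i+l\le r\le k+l-1$: $\sum_{s=1}^lf^{[r-l+1]}_{x_1,\dots,x_{i-1},x_{i-1+s},x_{i+l},\dots,x_{k+l-1}}(a_1,\dots,a_{i-1},g^{[s]}_{x_i,\dots,x_{i+l-1}}(a_i,\dots,a_{i+l-1}),a_{i+l},\dots,a_{k+l-1})$. (No further Koszul signs are introduced in these substitutions.) *)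

theory Defs
  imports "HOL-Computational_Algebra.Computational_Algebra"
begin

text \<open>
  The sets \<open>grad i\<close> are the homogeneous components; the last axiom is the internal direct sum
  decomposition. The element \<open>0\<close> is homogeneous of every degree.
\<close>

locale graded_module = module scale
  for scale :: "'k::comm_ring_1 \<Rightarrow> 'd::ab_group_add \<Rightarrow> 'd" +
  fixes grad :: "int \<Rightarrow> 'd set"
  assumes subspace_grad: "subspace (grad i)"
    and direct_sum:
      "\<exists>!c. (\<forall>i. c i \<in> grad i) \<and> finite {i. c i \<noteq> 0} \<and> x = (\<Sum>i\<in>{i. c i \<noteq> 0}. c i)"

text \<open>
  Linear maps out of a \<open>k\<close>-fold tensor product are represented by \<open>k\<close>-linear maps, that is, by
  functions on lists of length \<open>k\<close>. Their values on lists of other lengths are irrelevant.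
\<close>

definition multilinear ::
    "('k::comm_ring_1 \<Rightarrow> 'd::ab_group_add \<Rightarrow> 'd) \<Rightarrow> nat \<Rightarrow> ('d list \<Rightarrow> 'd) \<Rightarrow> bool" where
  "multilinear s k f \<longleftrightarrow>
     (\<forall>as j. length as = k \<longrightarrow> j < k \<longrightarrow> module_hom s s (\<lambda>y. f (as[j := y])))"

text \<open>
  \<open>homogeneous grad as d\<close>: the tuple \<open>as\<close> has homogeneous entries, the \<open>j\<close>-th one of degree
  \<open>d ! j\<close>.
\<close>

definition homogeneous :: "(int \<Rightarrow> 'c set) \<Rightarrow> 'c list \<Rightarrow> int list \<Rightarrow> bool" where
  "homogeneous grad as d \<longleftrightarrow> list_all2 (\<lambda>a e. a \<in> grad e) as d"

text \<open>
  Positions are counted from 1, as in \<open>a\<^sub>1, \<dots>, a\<^sub>n\<close>, whereas list indexing starts at 0.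
  \<open>block i l zs\<close> is \<open>z\<^sub>i, \<dots>, z\<^sub>i\<^sub>+\<^sub>l\<^sub>-\<^sub>1\<close>, and
  \<open>graft i l y zs\<close> is \<open>z\<^sub>1, \<dots>, z\<^sub>i\<^sub>-\<^sub>1, y, z\<^sub>i\<^sub>+\<^sub>l, \<dots>, z\<^sub>n\<close>.
\<close>

definition block :: "nat \<Rightarrow> nat \<Rightarrow> 'c list \<Rightarrow> 'c list" where
  "block i l zs = take l (drop (i - 1) zs)"

definition graft :: "nat \<Rightarrow> nat \<Rightarrow> 'c \<Rightarrow> 'c list \<Rightarrow> 'c list" where
  "graft i l y zs = take (i - 1) zs @ [y] @ drop (i - 1 + l) zs"

definition neg_one_pow :: "int \<Rightarrow> 'd::ab_group_add \<Rightarrow> 'd" where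
  "neg_one_pow e y = (if even e then y else - y)"

text \<open>
  The signed sum over \<open>k + l = n + 1\<close> (\<open>k, l \<ge> 1\<close>) and \<open>1 \<le> i \<le> k\<close> of terms \<open>T k l i\<close>,
  for inputs of degrees \<open>d\<close>.
\<close>

definition stasheff_sum ::
    "nat \<Rightarrow> int list \<Rightarrow> (nat \<Rightarrow> nat \<Rightarrow> nat \<Rightarrow> 'd::ab_group_add) \<Rightarrow> 'd" where
  "stasheff_sum n d T =
     (\<Sum>k = 1..n. let l = n + 1 - k in
        \<Sum>i = 1..k.
          neg_one_pow (int i * (int l + 1) + int l * sum_list (take (i - 1) d)) (T k l i))"

locale A_infinity_algebra = graded_module scale grad
  for scale :: "'k::comm_ring_1 \<Rightarrow> 'a::ab_group_add \<Rightarrow> 'a" and grad :: "int \<Rightarrow> 'a set" +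
  fixes \<mu> :: "nat \<Rightarrow> 'a list \<Rightarrow> 'a"
  assumes multilinear_\<mu>: "k \<ge> 1 \<Longrightarrow> multilinear scale k (\<mu> k)"
    and degree_\<mu>: "\<lbrakk>k \<ge> 1; length as = k; homogeneous grad as d\<rbrakk>
      \<Longrightarrow> \<mu> k as \<in> grad (sum_list d + (int k - 2))"
    and stasheff_\<mu>: "\<lbrakk>n \<ge> 1; length as = n; homogeneous grad as d\<rbrakk>
      \<Longrightarrow> stasheff_sum n d (\<lambda>k l i. \<mu> k (graft i l (\<mu> l (block i l as)) as)) = 0"

text \<open>
  Tuples of elements of \<open>A\<close> and \<open>M\<close> are lists over the sum type, with \<open>Inl\<close> marking elements of
  \<open>A\<close> and \<open>Inr\<close> elements of \<open>M\<close>. A linear map on \<open>\<A>\<^sup>k\<^sup>-\<^sup>1\<^sup>,\<^sup>1\<close> is a function on the lists of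
  length \<open>k\<close> with exactly one \<open>Inr\<close> entry that is linear in each entry.
\<close>

definition one_M :: "nat \<Rightarrow> ('a + 'm) list \<Rightarrow> bool" where
  "one_M k zs \<longleftrightarrow> length zs = k \<and> (\<exists>!j. j < k \<and> \<not> isl (zs ! j))"

definition mixed_multilinear ::
    "('k::comm_ring_1 \<Rightarrow> 'a::ab_group_add \<Rightarrow> 'a) \<Rightarrow> ('k \<Rightarrow> 'm::ab_group_add \<Rightarrow> 'm) \<Rightarrow>
     nat \<Rightarrow> (('a + 'm) list \<Rightarrow> 'm) \<Rightarrow> bool" where
  "mixed_multilinear sA sM k f \<longleftrightarrow>
     (\<forall>zs j. one_M k zs \<longrightarrow> j < k \<longrightarrow>
        (if isl (zs ! j) then module_hom sA sM (\<lambda>a. f (zs[j := Inl a]))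
         else module_hom sM sM (\<lambda>u. f (zs[j := Inr u]))))"

definition mixed_grad :: "(int \<Rightarrow> 'a set) \<Rightarrow> (int \<Rightarrow> 'm set) \<Rightarrow> int \<Rightarrow> ('a + 'm) set" where
  "mixed_grad gA gM e = Inl ` gA e \<union> Inr ` gM e"

text \<open>The operation \<open>\<mu>\<^sub>l\<close>, replaced by \<open>\<eta>\<^sub>l\<close> as soon as some input comes from \<open>M\<close>.\<close>

definition mixed_op ::
    "(nat \<Rightarrow> 'a list \<Rightarrow> 'a) \<Rightarrow> (nat \<Rightarrow> ('a + 'm) list \<Rightarrow> 'm) \<Rightarrow> nat \<Rightarrow> ('a + 'm) list \<Rightarrow> 'a + 'm" where
  "mixed_op \<mu> \<eta> l zs =
     (if \<forall>z\<in>set zs. isl z then Inl (\<mu> l (map projl zs)) else Inr (\<eta> l zs))"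

text \<open>
  In the identity for a bimodule the outer operation always has an input from \<open>M\<close>, either one of
  the untouched inputs or the value of the inner operation, so it is always \<open>\<eta>\<^sub>k\<close>.
\<close>

locale A_infinity_bimodule =
  A_infinity_algebra sA gA \<mu> + M: graded_module sM gM
  for sA :: "'k::comm_ring_1 \<Rightarrow> 'a::ab_group_add \<Rightarrow> 'a" and gA :: "int \<Rightarrow> 'a set"
    and \<mu> :: "nat \<Rightarrow> 'a list \<Rightarrow> 'a"
    and sM :: "'k \<Rightarrow> 'm::ab_group_add \<Rightarrow> 'm" and gM :: "int \<Rightarrow> 'm set" +
  fixes \<eta> :: "nat \<Rightarrow> ('a + 'm) list \<Rightarrow> 'm"
  assumes multilinear_\<eta>: "k \<ge> 1 \<Longrightarrow> mixed_multilinear sA sM k (\<eta> k)"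
    and degree_\<eta>: "\<lbrakk>k \<ge> 1; one_M k zs; homogeneous (mixed_grad gA gM) zs d\<rbrakk>
      \<Longrightarrow> \<eta> k zs \<in> gM (sum_list d + (int k - 2))"
    and stasheff_\<eta>: "\<lbrakk>n \<ge> 1; one_M n zs; homogeneous (mixed_grad gA gM) zs d\<rbrakk>
      \<Longrightarrow> stasheff_sum n d (\<lambda>k l i. \<eta> k (graft i l (mixed_op \<mu> \<eta> l (block i l zs)) zs)) = 0"

text \<open>
  \<open>insert_M P r xs us\<close> is the tuple \<open>P\<^sub>x\<^sub>1(u\<^sub>1), \<dots>, u\<^sub>r, \<dots>, P\<^sub>x\<^sub>k(u\<^sub>k)\<close>, where \<open>P\<close> is applied
  everywhere except at position \<open>r\<close> (counted from 1).
\<close>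

definition insert_M ::
    "('x \<Rightarrow> 'm \<Rightarrow> 'a) \<Rightarrow> nat \<Rightarrow> 'x list \<Rightarrow> 'm list \<Rightarrow> ('a + 'm) list" where
  "insert_M P r xs us = (map2 (\<lambda>x u. Inl (P x u)) xs us)[r - 1 := Inr (us ! (r - 1))]"

text \<open>The nonempty index set \<open>X\<close> is the type \<open>'x\<close>.\<close>

locale homotopy_matching_relative_Rota_Baxter_algebra =
  A_infinity_bimodule sA gA \<mu> sM gM \<eta>
  for sA :: "'k::comm_ring_1 \<Rightarrow> 'a::ab_group_add \<Rightarrow> 'a" and gA :: "int \<Rightarrow> 'a set"
    and \<mu> :: "nat \<Rightarrow> 'a list \<Rightarrow> 'a"
    and sM :: "'k \<Rightarrow> 'm::ab_group_add \<Rightarrow> 'm" and gM :: "int \<Rightarrow> 'm set"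
    and \<eta> :: "nat \<Rightarrow> ('a + 'm) list \<Rightarrow> 'm" +
  fixes P :: "'x \<Rightarrow> 'm \<Rightarrow> 'a"
  assumes linear_P: "module_hom sM sA (P x)"
    and degree_P: "u \<in> gM e \<Longrightarrow> P x u \<in> gA e"
    and Rota_Baxter: "\<lbrakk>k \<ge> 1; length xs = k; length us = k\<rbrakk>
      \<Longrightarrow> \<mu> k (map2 P xs us) = (\<Sum>r = 1..k. P (xs ! (r - 1)) (\<eta> k (insert_M P r xs us)))"

text \<open>
  An element \<open>f\<close> of \<open>\<O>\<^sub>D(k)\<close> is given by the \<open>k\<close>-linear maps \<open>f r xs\<close>, the values
  \<open>f\<^sub>x\<^sub>1\<^sub>,\<^sub>\<dots>\<^sub>,\<^sub>x\<^sub>k([r]; -, \<dots>, -)\<close> on the basis elements \<open>[r]\<close> (\<open>1 \<le> r \<le> k\<close>) of the free module on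
  \<open>C\<^sub>k\<close>.
\<close>

definition in_operad ::
    "('k::comm_ring_1 \<Rightarrow> 'd::ab_group_add \<Rightarrow> 'd) \<Rightarrow> nat \<Rightarrow>
     (nat \<Rightarrow> 'x list \<Rightarrow> 'd list \<Rightarrow> 'd) \<Rightarrow> bool" where
  "in_operad s k f \<longleftrightarrow>
     (\<forall>r\<in>{1..k}. \<forall>xs. length xs = k \<longrightarrow>
        multilinear s k (f r xs) \<and>
        (\<forall>y us. length us = k \<longrightarrow> f r (xs[r - 1 := y]) us = f r xs us))"

text \<open>The partial composition \<open>f \<circ>\<^sub>i g\<close> of \<open>f \<in> \<O>\<^sub>D(k)\<close> and \<open>g \<in> \<O>\<^sub>D(l)\<close>.\<close>

definition partial_comp ::
    "nat \<Rightarrow> nat \<Rightarrow> (nat \<Rightarrow> 'x list \<Rightarrow> 'd list \<Rightarrow> 'd::ab_group_add) \<Rightarrow>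
     (nat \<Rightarrow> 'x list \<Rightarrow> 'd list \<Rightarrow> 'd) \<Rightarrow> nat \<Rightarrow> 'x list \<Rightarrow> 'd list \<Rightarrow> 'd" where
  "partial_comp i l f g r xs as =
     (if r \<le> i - 1 then
        \<Sum>s = 1..l. f r (graft i l (xs ! (i - 1 + s - 1)) xs)
                       (graft i l (g s (block i l xs) (block i l as)) as)
      else if r \<le> i + l - 1 then
        f i (graft i l (xs ! (r - 1)) xs)
            (graft i l (g (r - i + 1) (block i l xs) (block i l as)) as)
      else
        \<Sum>s = 1..l. f (r - l + 1) (graft i l (xs ! (i - 1 + s - 1)) xs)
                       (graft i l (g s (block i l xs) (block i l as)) as))"

locale homotopy_matching_dendriform_algebra = graded_module scale grad
  for scale :: "'k::comm_ring_1 \<Rightarrow> 'd::ab_group_add \<Rightarrow> 'd" and grad :: "int \<Rightarrow> 'd set" +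
  fixes \<pi> :: "nat \<Rightarrow> nat \<Rightarrow> 'x list \<Rightarrow> 'd list \<Rightarrow> 'd"
  assumes in_operad_\<pi>: "k \<ge> 1 \<Longrightarrow> in_operad scale k (\<pi> k)"
    and degree_\<pi>:
      "\<lbrakk>k \<ge> 1; r \<in> {1..k}; length xs = k; length as = k; homogeneous grad as d\<rbrakk>
      \<Longrightarrow> \<pi> k r xs as \<in> grad (sum_list d + (int k - 2))"
    and stasheff_\<pi>:
      "\<lbrakk>n \<ge> 1; r \<in> {1..n}; length xs = n; length as = n; homogeneous grad as d\<rbrakk>
      \<Longrightarrow> stasheff_sum n d (\<lambda>k l i. partial_comp i l (\<pi> k) (\<pi> l) r xs as) = 0"

end

theory Submission
  imports Defs
begin

text \<open>
  Fix \<open>r\<close> and let \<open>z = (P\<^sub>x\<^sub>1(u\<^sub>1), \<dots>, u\<^sub>r, \<dots>, P\<^sub>x\<^sub>n(u\<^sub>n))\<close>. This tuple has exactly one entry from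
  \<open>M\<close>, so the bimodule identity applies to it; since every \<open>P\<^sub>x\<close> preserves degrees, its signs are
  those of \<open>(u\<^sub>1, \<dots>, u\<^sub>n)\<close>. The dendriform identity in component \<open>[r]\<close> is this identity, term
  by term: \<open>\<pi>\<^sub>k \<circ>\<^sub>i \<pi>\<^sub>l\<close> is the term of \<open>z\<close> in which \<open>\<eta>\<^sub>k\<close> receives the inner operation applied
  to the block of length \<open>l\<close> starting at \<open>i\<close> (lemma \<open>partial_comp_eq_bimodule_term\<close>).

  If the block contains position \<open>r\<close>, the inner operation is \<open>\<eta>\<^sub>l\<close>, its value is in \<open>M\<close>, and the
  two terms agree by definition. If the block misses position \<open>r\<close>, the inner operation is
  \<open>\<mu>\<^sub>l\<close> on arguments in the images of the \<open>P\<^sub>x\<close>. The Rota-Baxter identity writes it as the sum over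
  \<open>s\<close> of \<open>P\<close>, with the \<open>s\<close>-th index of the block, of an inner component \<open>[s]\<close>, and linearity of
  \<open>\<eta>\<^sub>k\<close> takes this sum out. The result is the sum over \<open>s\<close> by which \<open>\<circ>\<^sub>i\<close> is defined in the two
  outer cases.

  The remaining axioms are inherited from \<open>\<eta>\<close>, the maps \<open>P\<^sub>x\<close> being linear of degree \<open>0\<close>; the
  component \<open>[r]\<close> does not depend on \<open>x\<^sub>r\<close> because \<open>P\<close> is not applied at position \<open>r\<close>.
\<close>

section \<open>Blocks and grafts of tuples\<close>

lemma length_block: "i - 1 + l \<le> length zs \<Longrightarrow> length (block i l zs) = l"
  by (simp add: block_def)

lemma nth_block: "i - 1 + l \<le> length zs \<Longrightarrow> j < l \<Longrightarrow> block i l zs ! j = zs ! (i - 1 + j)"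
  by (simp add: block_def)

lemma length_graft:
  "i - 1 + l \<le> length zs \<Longrightarrow> length (graft i l y zs) = length zs + 1 - l"
  by (simp add: graft_def)

lemma nth_graft:
  assumes "i - 1 + l \<le> length zs" "j < length zs + 1 - l"
  shows "graft i l y zs ! j =
    (if j < i - 1 then zs ! j else if j = i - 1 then y else zs ! (j + l - 1))"
proof -
  have "j < i - 1 \<or> j = i - 1 \<or> (\<exists>m. j = i - 1 + Suc m)"
    by presburger
  then show ?thesis
    using assms by (auto simp: graft_def nth_append add_ac)
qed

lemma graft_list_update:
  "i - 1 + l \<le> length zs \<Longrightarrow> (graft i l y zs)[i - 1 := y'] = graft i l y' zs"
  by (simp add: graft_def list_update_append)

section \<open>Tuples with one entry from the bimodule\<close>

lemma length_insert_M: "length xs = k \<Longrightarrow> length us = k \<Longrightarrow> length (insert_M P r xs us) = k"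
  by (simp add: insert_M_def)

lemma nth_insert_M:
  "length xs = k \<Longrightarrow> length us = k \<Longrightarrow> j < k \<Longrightarrow>
    insert_M P r xs us ! j = (if j = r - 1 then Inr (us ! j) else Inl (P (xs ! j) (us ! j)))"
  by (simp add: insert_M_def nth_list_update)

lemma one_M_insert_M:
  assumes "r \<in> {1..k}" "length xs = k" "length us = k"
  shows "one_M k (insert_M P r xs us)"
  unfolding one_M_def using assms
  by (auto simp: length_insert_M nth_insert_M intro!: ex1I[of _ "r - 1"] split: if_splits)

lemma homogeneous_insert_M:
  assumes "\<And>x u e. u \<in> gM e \<Longrightarrow> P x u \<in> gA e"
    and "length xs = length us" "homogeneous gM us d"
  shows "homogeneous (mixed_grad gA gM) (insert_M P r xs us) d"
  using assms
  by (auto simp: homogeneous_def list_all2_conv_all_nth mixed_grad_def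
      length_insert_M[of _ "length us"] nth_insert_M[of _ "length us"])

lemma insert_M_index_update:
  "length xs = length us \<Longrightarrow> insert_M P r (xs[r - 1 := y]) us = insert_M P r xs us"
  by (rule nth_equalityI)
    (auto simp: length_insert_M[of _ "length us"] nth_insert_M[of _ "length us"] nth_list_update)

lemma insert_M_list_update:
  assumes "length xs = length us" "j < length us"
  shows "insert_M P r xs (us[j := y]) =
    (insert_M P r xs us)[j := (if j = r - 1 then Inr y else Inl (P (xs ! j) y))]"
  using assms
  by (intro nth_equalityI)
    (auto simp: length_insert_M[of _ "length us"] nth_insert_M[of _ "length us"] nth_list_update)

lemma block_insert_M_inside:
  assumes "1 \<le> i" "i \<le> r" "r < i + l" "i + l \<le> n + 1" "length xs = n" "length us = n"
  shows "block i l (insert_M P r xs us) = insert_M P (r - i + 1) (block i l xs) (block i l us)"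
  using assms
  by (intro nth_equalityI)
    (auto simp: length_block length_insert_M[of _ n] length_insert_M[of _ l] nth_block
      nth_insert_M[of _ n] nth_insert_M[of _ l])

lemma block_insert_M_outside:
  assumes "r < i \<or> i + l \<le> r" "1 \<le> i" "1 \<le> r" "i + l \<le> n + 1" "length xs = n" "length us = n"
  shows "block i l (insert_M P r xs us) = map Inl (map2 P (block i l xs) (block i l us))"
  using assms
  by (intro nth_equalityI)
    (auto simp: length_block length_insert_M[of _ n] nth_block nth_insert_M[of _ n])

lemma graft_insert_M_inside:
  assumes "1 \<le> l" "1 \<le> i" "i \<le> r" "r < i + l" "i + l \<le> n + 1" "length xs = n" "length us = n"
  shows "graft i l (Inr u) (insert_M P r xs us) = insert_M P i (graft i l x xs) (graft i l u us)"
  using assms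
  by (intro nth_equalityI)
    (auto simp: length_graft length_insert_M[of _ n] length_insert_M[of _ "n + 1 - l"] nth_graft
      nth_insert_M[of _ n] nth_insert_M[of _ "n + 1 - l"])

text \<open>
  Replacing a block of length \<open>l\<close> by one entry leaves the position of the entry from \<open>M\<close> alone if
  it precedes the block, and lowers it by \<open>l - 1\<close> if it follows.
\<close>

lemma graft_insert_M_outside:
  assumes "r < i \<or> i + l \<le> r" "1 \<le> l" "1 \<le> i" "1 \<le> r" "i + l \<le> n + 1"
    "length xs = n" "length us = n"
  shows "graft i l (Inl (P x u)) (insert_M P r xs us) =
    insert_M P (if r < i then r else r - l + 1) (graft i l x xs) (graft i l u us)"
proof (rule nth_equalityI)
  let ?q = "if r < i then r else r - l + 1"
  let ?zs = "insert_M P r xs us"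
  have lens: "i - 1 + l \<le> n" "length ?zs = n" "length (graft i l x xs) = n + 1 - l"
    "length (graft i l u us) = n + 1 - l"
    using assms by (auto simp: length_graft length_insert_M)
  then show "length (graft i l (Inl (P x u)) ?zs) =
      length (insert_M P ?q (graft i l x xs) (graft i l u us))"
    by (simp add: length_graft length_insert_M[where k = "n + 1 - l"])
  fix j
  assume "j < length (graft i l (Inl (P x u)) ?zs)"
  then have j: "j < n + 1 - l"
    using lens by (simp add: length_graft)
  consider "j < i - 1" | "j = i - 1" | "i - 1 < j" by linarith
  then show "graft i l (Inl (P x u)) ?zs ! j =
      insert_M P ?q (graft i l x xs) (graft i l u us) ! j"
  proof cases
    case 1
    moreover have "j = ?q - 1 \<longleftrightarrow> j = r - 1"
      using 1 assms(1-4) by auto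
    ultimately show ?thesis
      using j lens assms(6,7)
      by (simp add: nth_graft nth_insert_M[where k = n] nth_insert_M[where k = "n + 1 - l"]
          del: One_nat_def)
  next
    case 2
    moreover have "j \<noteq> ?q - 1"
      using 2 assms(1-4) by auto
    ultimately show ?thesis
      using j lens assms(6,7)
      by (simp add: nth_graft nth_insert_M[where k = "n + 1 - l"] del: One_nat_def)
  next
    case 3
    moreover have "j = ?q - 1 \<longleftrightarrow> j + l - 1 = r - 1"
      using 3 assms(1-4) by (cases "r < i") (simp_all, linarith+)
    moreover have "j + l - 1 < n"
      using j assms(2) by linarith
    ultimately show ?thesis
      using j lens assms(6,7)
      by (simp add: nth_graft nth_insert_M[where k = n] nth_insert_M[where k = "n + 1 - l"]
          del: One_nat_def)
  qed
qed

section \<open>The components of the dendriform operations\<close>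

lemma mixed_multilinear_sum_Inl:
  assumes "mixed_multilinear sA sM k f" "one_M k zs" "j < k" "isl (zs ! j)"
  shows "f (zs[j := Inl (\<Sum>s\<in>S. a s)]) = (\<Sum>s\<in>S. f (zs[j := Inl (a s)]))"
proof -
  interpret h: module_hom sA sM "\<lambda>a. f (zs[j := Inl a])"
    using assms by (auto simp: mixed_multilinear_def)
  show ?thesis by (rule h.sum)
qed

context homotopy_matching_relative_Rota_Baxter_algebra
begin

lemma multilinear_component:
  assumes "r \<in> {1..k}" "length xs = k"
  shows "multilinear sM k (\<lambda>us. \<eta> k (insert_M P r xs us))"
  unfolding multilinear_def
proof (intro allI impI)
  fix us :: "'m list" and j
  assume us: "length us = k" and j: "j < k"
  let ?zs = "insert_M P r xs us"
  have k: "1 \<le> k" using assms by simp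
  have "one_M k ?zs" using assms us by (rule one_M_insert_M)
  then have hom: "if isl (?zs ! j) then module_hom sA sM (\<lambda>a. \<eta> k (?zs[j := Inl a]))
         else module_hom sM sM (\<lambda>u. \<eta> k (?zs[j := Inr u]))"
    using multilinear_\<eta>[OF k] j by (simp add: mixed_multilinear_def)
  show "module_hom sM sM (\<lambda>y. \<eta> k (insert_M P r xs (us[j := y])))"
  proof (cases "j = r - 1")
    case True
    then show ?thesis
      using hom assms us j by (simp add: nth_insert_M[of _ k] insert_M_list_update)
  next
    case False
    then have "module_hom sA sM (\<lambda>a. \<eta> k (?zs[j := Inl a]))"
      using hom assms us j by (simp add: nth_insert_M[of _ k])
    from module_hom_compose[OF linear_P[of "xs ! j"] this] show ?thesis
      using False assms us j by (simp add: insert_M_list_update o_def)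
  qed
qed

text \<open>
  The Rota-Baxter identity, carried through \<open>\<eta>\<^sub>k\<close> in its \<open>i\<close>-th argument: this produces the sums
  over \<open>s\<close> in the two outer cases of \<open>\<circ>\<^sub>i\<close>.
\<close>

lemma bimodule_term_outside:
  assumes "r < i \<or> i + l \<le> r" "1 \<le> l" "1 \<le> i" "1 \<le> r" "r \<le> n" "i + l \<le> n + 1"
    and "length xs = n" "length us = n" "k + l = n + 1"
  defines "zs \<equiv> insert_M P r xs us"
  shows "\<eta> k (graft i l (mixed_op \<mu> \<eta> l (block i l zs)) zs) =
    (\<Sum>s = 1..l. \<eta> k (insert_M P (if r < i then r else r - l + 1)
       (graft i l (xs ! (i - 1 + s - 1)) xs)
       (graft i l (\<eta> l (insert_M P s (block i l xs) (block i l us))) us)))"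
proof -
  let ?a = "\<lambda>s. P (xs ! (i - 1 + s - 1)) (\<eta> l (insert_M P s (block i l xs) (block i l us)))"
  \<comment> \<open>The entry \<open>P x 0\<close> is a placeholder: multilinearity speaks about updates of a given tuple.\<close>
  let ?ws = "graft i l (Inl (P undefined 0)) zs"
  have len: "length zs = n"
    using assms by (simp add: length_insert_M)
  have lens: "i - 1 + l \<le> length zs" "i - 1 + l \<le> length xs" "i - 1 + l \<le> length us"
    using assms len by auto
  have k: "k = n + 1 - l" "1 \<le> k" "i - 1 < k"
    using assms by auto
  have "mixed_op \<mu> \<eta> l (block i l zs) = Inl (\<mu> l (map2 P (block i l xs) (block i l us)))"
    unfolding zs_def block_insert_M_outside[OF assms(1,3,4,6,7,8)]
    by (simp add: mixed_op_def comp_def)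
  also have "\<mu> l (map2 P (block i l xs) (block i l us)) = (\<Sum>s = 1..l. ?a s)"
    using assms(2,3) lens
    by (auto simp: Rota_Baxter length_block nth_block intro!: sum.cong)
  finally have op: "mixed_op \<mu> \<eta> l (block i l zs) = Inl (\<Sum>s = 1..l. ?a s)" .
  have "one_M k ?ws"
    unfolding zs_def graft_insert_M_outside[where P = P, OF assms(1-4,6,7,8)]
    using assms(1-6) lens assms(7,8) k by (intro one_M_insert_M) (auto simp: length_graft)
  moreover have "isl (?ws ! (i - 1))"
    using lens k len by (simp add: nth_graft)
  ultimately have "\<eta> k (?ws[i - 1 := Inl (\<Sum>s = 1..l. ?a s)]) =
      (\<Sum>s = 1..l. \<eta> k (?ws[i - 1 := Inl (?a s)]))"
    using multilinear_\<eta>[OF k(2)] k(3) by (intro mixed_multilinear_sum_Inl)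
  then show ?thesis
    unfolding op graft_list_update[OF lens(1)]
    unfolding zs_def graft_insert_M_outside[where P = P, OF assms(1-4,6,7,8)] .
qed

text \<open>
  The three cases of \<open>\<circ>\<^sub>i\<close> record whether the entry from \<open>M\<close> lies before, in or after the block
  fed to the inner operation, hence whether that operation is \<open>\<mu>\<^sub>l\<close> or \<open>\<eta>\<^sub>l\<close>.
\<close>

lemma partial_comp_eq_bimodule_term:
  fixes \<pi> :: "nat \<Rightarrow> nat \<Rightarrow> 'x list \<Rightarrow> 'm list \<Rightarrow> 'm"
  assumes \<pi>: "\<And>k r xs us. \<lbrakk>k \<ge> 1; r \<in> {1..k}; length xs = k; length us = k\<rbrakk>
      \<Longrightarrow> \<pi> k r xs us = \<eta> k (insert_M P r xs us)"
    and "1 \<le> l" "1 \<le> i" "i \<le> k" "k + l = n + 1" "r \<in> {1..n}" "length xs = n" "length us = n"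
  defines "zs \<equiv> insert_M P r xs us"
  shows "partial_comp i l (\<pi> k) (\<pi> l) r xs us =
    \<eta> k (graft i l (mixed_op \<mu> \<eta> l (block i l zs)) zs)"
proof -
  have lens: "i - 1 + l \<le> length xs" "i - 1 + l \<le> length us"
    using assms by auto
  have inner: "\<pi> l s (block i l xs) (block i l us) =
      \<eta> l (insert_M P s (block i l xs) (block i l us))" if "s \<in> {1..l}" for s
    using that assms(2) lens by (intro \<pi>) (auto simp: length_block)
  have outer: "\<pi> k q (graft i l x xs) (graft i l u us) =
      \<eta> k (insert_M P q (graft i l x xs) (graft i l u us))" if "q \<in> {1..k}" for q x u
    using that assms(2-5,7,8) lens by (intro \<pi>) (auto simp: length_graft)
  show ?thesis
  proof (cases "i \<le> r \<and> r < i + l")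
    case True
    have blk: "block i l zs = insert_M P (r - i + 1) (block i l xs) (block i l us)"
      unfolding zs_def using True assms(3-8) by (intro block_insert_M_inside) auto
    \<comment> \<open>The block contains the entry from \<open>M\<close>, so the inner operation is \<open>\<eta> l\<close>.\<close>
    have "one_M l (block i l zs)"
      unfolding blk using True assms(3) lens by (intro one_M_insert_M) (auto simp: length_block)
    then have "\<not> (\<forall>z\<in>set (block i l zs). isl z)"
      by (auto simp: one_M_def dest: nth_mem)
    then have op: "mixed_op \<mu> \<eta> l (block i l zs) =
        Inr (\<eta> l (insert_M P (r - i + 1) (block i l xs) (block i l us)))"
      unfolding mixed_op_def blk by (simp del: One_nat_def)
    show ?thesis
      unfolding op unfolding zs_def
      using True assms(2-8)
      by (subst graft_insert_M_inside[where n = n and x = "xs ! (r - 1)"])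
        (auto simp: partial_comp_def inner outer)
  next
    case False
    then have "r < i \<or> i + l \<le> r" by auto
    then show ?thesis
      unfolding zs_def using assms(2-8)
      by (subst bimodule_term_outside[where n = n])
        (auto simp: partial_comp_def inner outer intro!: sum.cong)
  qed
qed

end

theorem proposition6p11:
  fixes sA :: "'k::comm_ring_1 \<Rightarrow> 'a::ab_group_add \<Rightarrow> 'a"
    and sM :: "'k \<Rightarrow> 'm::ab_group_add \<Rightarrow> 'm"
    and P :: "'x \<Rightarrow> 'm \<Rightarrow> 'a"
    and \<pi> :: "nat \<Rightarrow> nat \<Rightarrow> 'x list \<Rightarrow> 'm list \<Rightarrow> 'm"
  assumes "CHAR('k) \<noteq> 2"
    and "homotopy_matching_relative_Rota_Baxter_algebra sA gA \<mu> sM gM \<eta> P"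
    and "\<And>k r xs us. \<lbrakk>k \<ge> 1; r \<in> {1..k}; length xs = k; length us = k\<rbrakk>
      \<Longrightarrow> \<pi> k r xs us = \<eta> k (insert_M P r xs us)"
  shows "homotopy_matching_dendriform_algebra sM gM \<pi>"
proof -
  interpret homotopy_matching_relative_Rota_Baxter_algebra sA gA \<mu> sM gM \<eta> P
    by (fact assms(2))
  note \<pi> = assms(3)
  show ?thesis
  proof
    fix k :: nat
    assume k: "k \<ge> 1"
    show "in_operad sM k (\<pi> k)"
      unfolding in_operad_def
    proof (intro ballI allI impI conjI)
      fix r and xs :: "'x list"
      assume r: "r \<in> {1..k}" and xs: "length xs = k"
      show "multilinear sM k (\<pi> k r xs)"
        using multilinear_component[OF r xs] by (simp add: multilinear_def \<pi>[OF k r xs])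
      fix y and us :: "'m list"
      assume "length us = k"
      then show "\<pi> k r (xs[r - 1 := y]) us = \<pi> k r xs us"
        using k r xs by (simp add: \<pi> insert_M_index_update del: One_nat_def)
    qed
  next
    fix k r :: nat and xs :: "'x list" and us d
    assume *: "k \<ge> 1" "r \<in> {1..k}" "length xs = k" "length us = k" "homogeneous gM us d"
    then show "\<pi> k r xs us \<in> gM (sum_list d + (int k - 2))"
      unfolding \<pi>[OF *(1-4)]
      by (intro degree_\<eta> one_M_insert_M homogeneous_insert_M degree_P) auto
  next
    fix n r :: nat and xs :: "'x list" and us d
    assume *: "n \<ge> 1" "r \<in> {1..n}" "length xs = n" "length us = n" "homogeneous gM us d"
    let ?zs = "insert_M P r xs us"
    have "stasheff_sum n d (\<lambda>k l i. partial_comp i l (\<pi> k) (\<pi> l) r xs us) =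
        stasheff_sum n d (\<lambda>k l i. \<eta> k (graft i l (mixed_op \<mu> \<eta> l (block i l ?zs)) ?zs))"
      unfolding stasheff_sum_def Let_def
      using * by (intro sum.cong refl arg_cong[where f = "neg_one_pow _"]
          partial_comp_eq_bimodule_term[where n = n] \<pi>) auto
    also have "\<dots> = 0"
      using * by (intro stasheff_\<eta> one_M_insert_M homogeneous_insert_M degree_P) auto
    finally show "stasheff_sum n d (\<lambda>k l i. partial_comp i l (\<pi> k) (\<pi> l) r xs us) = 0" .
  qed
qed

end
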